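(* For all $n, d \in \mathbb{N}$ there exists a number $g = g(n,d)$ such that the following holds. Let $S = \mathbb{R}^d \setminus (\bigcup_{i=1}^n K_i)$, where $K_1, \ldots, K_n \subset \mathbb{R}^d$ are convex sets. Then $S$ can be covered by at most $g$ flats in such a way that each $p \in S$ is covered by a flat (of the collection) of dimension exactly $dm(S,p)$. Furthermore, there exists a unique such cover $\mathcal{C}$ that is minimal with respect to inclusion; that is, $S$ admits a unique strong cover $\mathcal{C}$. Moreover, $\mathcal{C}$ is the collection of all ordinary flats with respect to $S$.
   Context: A flat is an affine subspace of $\mathbb{R}^d$; a $k$-flat is a $k$-dimensional affine subspace. $B(p,\epsilon)$ is the open ball of radius $\epsilon$ centered at $p$. For $k \ge -1$, a $k$-simplex is the convex hull of $k+1$ affinely independent points of $\mathbb{R}^d$. For $S \subset \mathbb{R}^d$, the flat-dimension is $dm(S) = \max\{k : S \text{ includes a } k\text{-simplex}\}$ (so $dm(\emptyset) = -1$). For $p \in S$, the local dimension of $S$ at $p$ is $dm(S,p) = \min_{\epsilon > 0} dm(S \cap B(p,\epsilon))$. A strong cover of $S \subset \mathbb{R}^d$ is a collection $\mathcal{C}$ of flats in $\mathbb{R}^d$ such that: (1) $|\mathcal{C}| < \infty$; (2) each point $p \in S$ belongs to some $k$-flat $H \in \mathcal{C}$ with $k = dm(S,p)$; (3) $\mathcal{C}$ is minimal, i.e., no proper subcollection of $\mathcal{C}$ satisfies (2). A point $p \in S$ is a $k$-ordinary point of $S$ if $dm(S,p) = k$ and there are a $k$-flat $H \subset \mathbb{R}^d$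 and an open neighborhood $U$ of $p$ with $S \cap U = H \cap U$; such an $H$ is called a $k$-ordinary flat of (or with respect to) $S$. An ordinary flat of $S$ is a $k$-ordinary flat for some $0 \le k \le d$. *)

theory Defs
  imports "HOL-Analysis.Analysis"
begin

(* The library's affine admits the empty set, so non-emptiness is added here. *)
definition flat :: "'a::euclidean_space set \<Rightarrow> bool" where
  "flat H \<longleftrightarrow> affine H \<and> H \<noteq> {}"

definition k_flat :: "int \<Rightarrow> 'a::euclidean_space set \<Rightarrow> bool" where
  "k_flat k H \<longleftrightarrow> flat H \<and> aff_dim H = k"

(* The (-1)-simplex is the empty set, so flat_dim {} = -1. See
   flat_dim_attained and local_dim_attained for well-definedness of Max and Min. *)
definition simplex_dims :: "'a::euclidean_space set \<Rightarrow> int set" where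
  "simplex_dims S = {k. \<exists>T. k simplex T \<and> T \<subseteq> S}"

definition flat_dim :: "'a::euclidean_space set \<Rightarrow> int" where
  "flat_dim S = Max (simplex_dims S)"

definition local_dim :: "'a::euclidean_space set \<Rightarrow> 'a \<Rightarrow> int" where
  "local_dim S p = Min ((\<lambda>\<epsilon>. flat_dim (S \<inter> ball p \<epsilon>)) ` {0<..})"

definition dim_cover :: "'a::euclidean_space set \<Rightarrow> 'a set set \<Rightarrow> bool" where
  "dim_cover S C \<longleftrightarrow> (\<forall>p\<in>S. \<exists>H\<in>C. k_flat (local_dim S p) H \<and> p \<in> H)"

definition strong_cover :: "'a::euclidean_space set \<Rightarrow> 'a set set \<Rightarrow> bool" where
  "strong_cover S C \<longleftrightarrow>
     (\<forall>H\<in>C. flat H) \<and> finite C \<and> dim_cover S C \<and> (\<forall>C'. C' \<subset> C \<longrightarrow> \<not> dim_cover S C')"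

definition k_ordinary_flat :: "int \<Rightarrow> 'a::euclidean_space set \<Rightarrow> 'a set \<Rightarrow> bool" where
  "k_ordinary_flat k S H \<longleftrightarrow>
     k_flat k H \<and>
     (\<exists>p\<in>S. local_dim S p = k \<and> (\<exists>U. open U \<and> p \<in> U \<and> S \<inter> U = H \<inter> U))"

definition ordinary_flat :: "'a::euclidean_space set \<Rightarrow> 'a set \<Rightarrow> bool" where
  "ordinary_flat S H \<longleftrightarrow> (\<exists>k. 0 \<le> k \<and> k \<le> int DIM('a) \<and> k_ordinary_flat k S H)"

lemma simplex_dims_subset: "simplex_dims (S :: 'a::euclidean_space set) \<subseteq> {-1..int DIM('a)}"
  unfolding simplex_dims_def
  by (auto dest!: aff_dim_simplex intro: order_trans[OF _ aff_dim_le_DIM])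
     (metis aff_dim_geq aff_dim_le_DIM)+

lemma minus_one_in_simplex_dims: "-1 \<in> simplex_dims S"
  unfolding simplex_dims_def by (auto simp: simplex_minus_1)

lemma flat_dim_attained: "flat_dim S \<in> simplex_dims S"
  unfolding flat_dim_def
  using minus_one_in_simplex_dims[of S] finite_subset[OF simplex_dims_subset[of S]]
  by (intro Max_in) auto

lemma local_dim_attained:
  "local_dim S p \<in> (\<lambda>\<epsilon>. flat_dim (S \<inter> ball p \<epsilon>)) ` {0<..}"
  for S :: "'a::euclidean_space set"
proof -
  have "(\<lambda>\<epsilon>. flat_dim (S \<inter> ball p \<epsilon>)) ` {0<..} \<subseteq> {-1..int DIM('a)}"
    using flat_dim_attained simplex_dims_subset by blast
  then have "finite ((\<lambda>\<epsilon>. flat_dim (S \<inter> ball p \<epsilon>)) ` {0<..})"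
    using finite_subset by blast
  moreover have "(1::real) \<in> {0<..}" by simp
  ultimately show ?thesis
    unfolding local_dim_def by (intro Min_in) blast+
qed

end

theory Submission
  imports Defs
begin

text \<open>
  Let \<open>U\<^sub>i\<close> be the interior of \<open>K\<^sub>i\<close> relative to a flat \<open>H\<close>, let \<open>p \<in> S \<inter> H\<close> be outside the closure of
  the relative interior of \<open>S \<inter> H\<close>, and let \<open>J\<close> be the set of those \<open>i\<close> for which \<open>p\<close> is in the closure
  of \<open>U\<^sub>i\<close>. Near \<open>p\<close> the union of the \<open>U\<^sub>i\<close> with \<open>i \<in> J\<close> is dense in \<open>H\<close>, which forces these \<open>U\<^sub>i\<close> to have
  empty intersection. Enlarging them one after the other to half-spaces while keeping the intersection
  empty, one sees that \<open>p\<close> is on one of the at most \<open>|J|\<close> bounding hyperplanes, which depend on \<open>J\<close>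
  only. So all such \<open>p\<close> are covered by at most \<open>n 2\<^sup>n\<close> proper subflats of \<open>H\<close>, and induction on
  the dimension gives boundedly many flats \<open>F\<close> such that each \<open>p \<in> S\<close> is in the closure of the
  relative interior of \<open>S \<inter> F\<close> for one of them.

  A convex set covered by finitely many flats lies in one of them. Applied to small simplices in \<open>S\<close>
  near \<open>p\<close>, this shows that these flats cover \<open>p\<close> in the right dimension, that every finite cover
  contains all ordinary flats, and that a minimal cover contains nothing else.
\<close>

section \<open>Separation of relatively open convex sets\<close>

text \<open>Separate \<open>0\<close> from the difference set \<open>D\<close> by a functional that
  is positive somewhere on \<open>D\<close> and thus not constant on \<open>H\<close>. As
  \<open>U\<close> is open in \<open>H\<close>, it cannot attain the infimum \<open>b\<close> of
  this functional over \<open>W\<close>.\<close>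

lemma separating_halfspace_openin:
  fixes H :: "'a::euclidean_space set"
  assumes "affine H" "convex U" "convex W"
    and opU: "openin (top_of_set H) U" and opW: "openin (top_of_set H) W"
    and "U \<noteq> {}" "W \<noteq> {}" "U \<inter> W = {}"
  obtains a b where "U \<subseteq> {x. a \<bullet> x < b}" "W \<inter> {x. a \<bullet> x < b} = {}"
proof -
  define D where "D = (\<Union>w\<in>W. \<Union>u\<in>U. {w - u})"
  have D: "convex D" "D \<noteq> {}" "0 \<notin> D"
    unfolding D_def using assms convex_differences[of W U] by auto
  obtain a where a: "\<And>y. y \<in> D \<Longrightarrow> 0 \<le> a \<bullet> y" "\<exists>y\<in>D. 0 < a \<bullet> y"
  \<comment> \<open>In the closure, \<open>0\<close> is a relative boundary point of
    \<open>D\<close>, where a supporting hyperplane is strict on the relative interior; outside it,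
    strict separation applies.\<close>
  proof (cases "0 \<in> closure D")
    case True
    moreover have "0 \<notin> rel_interior D"
      using D(3) rel_interior_subset by blast
    ultimately obtain a where "\<And>y. y \<in> closure D \<Longrightarrow> a \<bullet> 0 \<le> a \<bullet> y"
        "\<And>y. y \<in> rel_interior D \<Longrightarrow> a \<bullet> 0 < a \<bullet> y"
      using supporting_hyperplane_relative_frontier[OF D(1)] by metis
    then show ?thesis
      using that[of a] D closure_subset[of D] rel_interior_eq_empty[OF D(1)]
        rel_interior_subset[of D] by (metis all_not_in_conv inner_zero_right subsetD)
  next
    case False
    then obtain a b where ab: "a \<bullet> 0 < b" "\<forall>x\<in>closure D. a \<bullet> x > b"
      using separating_hyperplane_closed_point[of "closure D" 0] D(1) convex_closure by blast
    show ?thesis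
    proof (rule that[of a])
      show *: "0 \<le> a \<bullet> y" if "y \<in> D" for y
        using ab that closure_subset[of D] by force
      show "\<exists>y\<in>D. 0 < a \<bullet> y"
        using ab D closure_subset[of D] by (force simp: subset_iff)
    qed
  qed
  have le: "a \<bullet> u \<le> a \<bullet> w" if "u \<in> U" "w \<in> W" for u w
    using a(1)[of "w - u"] that unfolding D_def by (auto simp: inner_diff_right)
  obtain u0 w0 where uw: "u0 \<in> U" "w0 \<in> W" "a \<bullet> u0 < a \<bullet> w0"
    using a(2) unfolding D_def by (auto simp: inner_diff_right)
  define b where "b = Inf ((\<bullet>) a ` W)"
  have bdd: "bdd_below ((\<bullet>) a ` W)"
    by (rule bdd_belowI2[of _ "a \<bullet> u0"]) (use le uw in auto)
  have Wb: "b \<le> a \<bullet> w" if "w \<in> W" for w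
    unfolding b_def using bdd that by (intro cInf_lower) auto
  have Ub: "a \<bullet> u \<le> b" if "u \<in> U" for u
    unfolding b_def using le that \<open>W \<noteq> {}\<close> by (intro cInf_greatest) auto
  have "a \<bullet> u < b" if u: "u \<in> U" for u
  proof -
    have sub: "U \<subseteq> H" "W \<subseteq> H"
      using opU opW openin_imp_subset by blast+
    obtain e where e: "e > 0" "ball u e \<inter> H \<subseteq> U"
      using opU u by (auto simp: openin_contains_ball)
    \<comment> \<open>The move from \<open>u\<close> to \<open>v\<close> has length
      \<open>e / 2\<close>, so \<open>v\<close> stays in \<open>U\<close>, and it increases the
      functional.\<close>
    define t where "t = e / (2 * norm (w0 - u0))"
    have ne: "norm (w0 - u0) > 0"
      using uw by auto
    have t: "t > 0" "norm (t *\<^sub>R (w0 - u0)) < e"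
      unfolding t_def norm_scaleR using e ne by (auto simp: field_simps)
    define v where "v = u + t *\<^sub>R (w0 - u0)"
    have "v \<in> H"
      unfolding v_def using mem_affine_3_minus[OF \<open>affine H\<close>, of u w0 u0 t] u uw sub by auto
    moreover have "v \<in> ball u e"
      unfolding v_def using t by (simp add: dist_norm)
    ultimately have "a \<bullet> v \<le> b"
      using Ub e by auto
    moreover have "a \<bullet> u < a \<bullet> v"
      unfolding v_def using t uw by (simp add: inner_add_right inner_diff_right)
    ultimately show ?thesis
      by linarith
  qed
  then show ?thesis
    using that[of a b] Wb by force
qed

text \<open>Induction on \<open>A\<close>, where \<open>W\<close> collects the half-spaces that
  replace sets \<open>U i\<close>. If a half-space contains \<open>U i\<close> and misses
  \<open>V\<close>, the intersection stays empty after the replacement, and a point of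
  \<open>W\<close> in the closure of \<open>U i\<close> is on the bounding hyperplane or in the
  smaller \<open>W'\<close>. So each index costs at most one hyperplane.\<close>

lemma empty_intersection_closures_covered:
  fixes H :: "'a::euclidean_space set"
  assumes "finite A" "affine H"
    and "\<And>i. i \<in> A \<Longrightarrow> convex (U i) \<and> openin (top_of_set H) (U i) \<and> U i \<noteq> {}"
    and "convex W" "openin (top_of_set H) W" "W \<inter> (\<Inter>i\<in>A. U i) = {}"
  shows "\<exists>\<L>. finite \<L> \<and> card \<L> \<le> card A \<and> (\<forall>L\<in>\<L>. affine L \<and> L \<subset> H) \<and>
           W \<inter> (\<Inter>i\<in>A. closure (U i)) \<subseteq> \<Union>\<L>"
  using assms(1,3-)
proof (induction A arbitrary: W rule: finite_induct)
  case empty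
  then show ?case
    by (intro exI[of _ "{}"]) auto
next
  case (insert i A)
  define V where "V = W \<inter> (\<Inter>i\<in>A. U i)"
  have V: "convex V" "openin (top_of_set H) V" "U i \<inter> V = {}"
  proof -
    show "convex V"
      unfolding V_def using insert.prems by (auto intro!: convex_Int convex_INT)
    show "openin (top_of_set H) V"
    proof (cases "A = {}")
      case True
      then show ?thesis unfolding V_def using insert.prems by simp
    next
      case False
      have "openin (top_of_set H) (\<Inter>i\<in>A. U i)"
        using False \<open>finite A\<close> insert.prems(1) by (intro openin_INT2) blast+
      then show ?thesis unfolding V_def using insert.prems(3) by (intro openin_Int)
    qed
    show "U i \<inter> V = {}"
      unfolding V_def using insert.prems by auto
  qed
  show ?case
  proof (cases "V = {}")
    case True
    have "\<exists>\<L>. finite \<L> \<and> card \<L> \<le> card A \<and> (\<forall>L\<in>\<L>. affine L \<and> L \<subset> H) \<and>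
        W \<inter> (\<Inter>i\<in>A. closure (U i)) \<subseteq> \<Union>\<L>"
      using True insert.prems unfolding V_def by (intro insert.IH) simp_all
    then obtain \<L> where \<L>: "finite \<L>" "card \<L> \<le> card A"
        "\<forall>L\<in>\<L>. affine L \<and> L \<subset> H" "W \<inter> (\<Inter>i\<in>A. closure (U i)) \<subseteq> \<Union>\<L>"
      by blast
    moreover have "card \<L> \<le> card (insert i A)"
      using \<L>(2) insert.hyps by simp
    ultimately show ?thesis
      by (intro exI[of _ \<L>]) auto
  next
    case False
    obtain a b where ab: "U i \<subseteq> {x. a \<bullet> x < b}" "V \<inter> {x. a \<bullet> x < b} = {}"
      using separating_halfspace_openin[OF \<open>affine H\<close> _ V(1) _ V(2) _ False V(3)]
        insert.prems(1)[of i] by auto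
    define W' where "W' = W \<inter> {x. a \<bullet> x < b}"
    define L where "L = H \<inter> {x. a \<bullet> x = b}"
    have "openin (top_of_set H) W'"
      unfolding W'_def using insert.prems open_halfspace_lt[of a b] by (simp add: openin_Int_open)
    moreover have "convex W'"
      unfolding W'_def using insert.prems convex_halfspace_lt by (auto intro!: convex_Int)
    moreover have "W' \<inter> (\<Inter>i\<in>A. U i) = {}"
      using ab(2) unfolding W'_def V_def by blast
    ultimately have "\<exists>\<L>. finite \<L> \<and> card \<L> \<le> card A \<and> (\<forall>L\<in>\<L>. affine L \<and> L \<subset> H) \<and>
        W' \<inter> (\<Inter>i\<in>A. closure (U i)) \<subseteq> \<Union>\<L>"
      using insert.prems(1) by (intro insert.IH) simp_all
    then obtain \<L> where \<L>: "finite \<L>" "card \<L> \<le> card A"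
        "\<forall>L\<in>\<L>. affine L \<and> L \<subset> H" "W' \<inter> (\<Inter>i\<in>A. closure (U i)) \<subseteq> \<Union>\<L>"
      by blast
    have "affine L"
      unfolding L_def using \<open>affine H\<close> affine_hyperplane by (rule affine_Int)
    moreover have "L \<subset> H"
    proof -
      obtain u where "u \<in> U i" "u \<in> H"
        using insert.prems openin_imp_subset by blast
      then show ?thesis
        using ab(1) unfolding L_def by fastforce
    qed
    moreover have "W \<inter> (\<Inter>j\<in>insert i A. closure (U j)) \<subseteq> \<Union>(insert L \<L>)"
    proof
      fix p assume p: "p \<in> W \<inter> (\<Inter>j\<in>insert i A. closure (U j))"
      have "closure (U i) \<subseteq> {x. a \<bullet> x \<le> b}"
        using ab(1) closed_halfspace_le[of a b] by (intro closure_minimal) auto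
      then have "a \<bullet> p \<le> b" "p \<in> H"
        using p insert.prems(3) openin_imp_subset by blast+
      then show "p \<in> \<Union>(insert L \<L>)"
        using p \<L>(4) unfolding L_def W'_def by (cases "a \<bullet> p = b") fastforce+
    qed
    moreover have "card (insert L \<L>) \<le> card (insert i A)"
      using \<L>(1,2) insert.hyps by (simp add: card_insert_if)
    ultimately show ?thesis
      using \<L> by (intro exI[of _ "insert L \<L>"]) auto
  qed
qed

section \<open>Interiors of convex sets relative to a flat\<close>

text \<open>A nonempty interior in \<open>H\<close> forces \<open>K \<inter> H\<close> to span
  \<open>H\<close>; then it is the relative interior, which is convex.\<close>

lemma convex_interior_of_affine:
  fixes H :: "'a::euclidean_space set"
  assumes "affine H" "convex K"
  shows "convex (top_of_set H interior_of K)"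
proof -
  have *: "top_of_set H interior_of K = top_of_set H interior_of (K \<inter> H)"
    by (metis inf_commute interior_of_restrict topspace_euclidean_subtopology)
  have KH: "convex (K \<inter> H)"
    using assms affine_imp_convex by (blast intro: convex_Int)
  show ?thesis
  proof (cases "top_of_set H interior_of (K \<inter> H) = {}")
    case True
    then show ?thesis using * by simp
  next
    case False
    have "affine hull (K \<inter> H) = H"
    proof
      show "affine hull (K \<inter> H) \<subseteq> H"
        by (simp add: assms(1) hull_minimal)
      have "affine hull (top_of_set H interior_of (K \<inter> H)) = affine hull H"
        using False affine_hull_openin[of H] assms(1)
        by (metis affine_hull_eq openin_interior_of)
      then show "H \<subseteq> affine hull (K \<inter> H)"
        by (metis hull_mono hull_subset interior_of_subset subset_trans)
    qed
    then have "top_of_set H interior_of (K \<inter> H) = rel_interior (K \<inter> H)"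
      by (auto simp: interior_of_def rel_interior_def)
    then show ?thesis
      using * convex_rel_interior[OF KH] by simp
  qed
qed

text \<open>A convex set and its closure have the same relative interior, so a convex set cannot be
  dense in an open piece of \<open>H\<close> without containing it.\<close>

lemma convex_openin_refine:
  fixes H :: "'a::euclidean_space set"
  assumes "affine H" "convex K" "openin (top_of_set H) V" "V \<noteq> {}"
  obtains V' where "V' \<subseteq> V" "openin (top_of_set H) V'" "V' \<noteq> {}" "V' \<subseteq> K \<or> V' \<inter> K = {}"
proof (cases "V \<subseteq> closure (K \<inter> H)")
  case False
  have "openin (top_of_set H) (V - closure (K \<inter> H))"
    using assms(3) by (metis Diff_eq openin_Int_open closed_closure open_Compl)
  moreover have "(V - closure (K \<inter> H)) \<inter> K = {}"
    using closure_subset[of "K \<inter> H"] openin_imp_subset[OF assms(3)] by blast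
  ultimately show ?thesis
    using False that[of "V - closure (K \<inter> H)"] by blast
next
  case True
  have "affine hull closure (K \<inter> H) = H"
  proof
    show "affine hull closure (K \<inter> H) \<subseteq> H"
      using affine_closed[OF assms(1)] assms(1) by (intro hull_minimal closure_minimal) auto
    have "affine hull V = H"
      using assms by (metis affine_hull_eq affine_hull_openin)
    then show "H \<subseteq> affine hull closure (K \<inter> H)"
      using True hull_mono by metis
  qed
  then have "V \<subseteq> rel_interior (closure (K \<inter> H))"
    using rel_interior_maximal True assms(3) by metis
  also have "\<dots> = rel_interior (K \<inter> H)"
    using assms affine_imp_convex by (intro convex_rel_interior_closure) (blast intro: convex_Int)
  finally show ?thesis
    using that[of V] assms(3,4) rel_interior_subset by blast
qed

lemma convex_family_openin_refine:
  fixes H :: "'a::euclidean_space set"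
  assumes "finite I" "affine H" "\<And>i. i \<in> I \<Longrightarrow> convex (K i)"
    and "openin (top_of_set H) V" "V \<noteq> {}"
  shows "\<exists>V'. V' \<subseteq> V \<and> openin (top_of_set H) V' \<and> V' \<noteq> {} \<and>
           ((\<exists>i\<in>I. V' \<subseteq> K i) \<or> V' \<inter> (\<Union>i\<in>I. K i) = {})"
  using assms(1,3)
proof (induction I rule: finite_induct)
  case empty
  then show ?case using assms by auto
next
  case (insert i I)
  then obtain V1 where V1: "V1 \<subseteq> V" "openin (top_of_set H) V1" "V1 \<noteq> {}"
      "(\<exists>i\<in>I. V1 \<subseteq> K i) \<or> V1 \<inter> (\<Union>i\<in>I. K i) = {}"
    by auto
  obtain V2 where "V2 \<subseteq> V1" "openin (top_of_set H) V2" "V2 \<noteq> {}" "V2 \<subseteq> K i \<or> V2 \<inter> K i = {}"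
    using convex_openin_refine[OF assms(2) _ V1(2,3), of "K i"] insert.prems by blast
  then show ?case
    using V1 by (intro exI[of _ V2]) blast
qed

section \<open>Covering the complement by boundedly many flats\<close>

text \<open>At most \<open>card J\<close> subflats for each \<open>J \<subseteq> I\<close> give the
  bound. An uncovered \<open>p\<close> would lie strictly between a common point \<open>w\<close> of
  the \<open>U i\<close> with \<open>i \<in> J\<close> and a point \<open>y\<close> in the closure
  of one of them, hence in \<open>K i\<close>.\<close>

lemma complement_covered_up_to_interior:
  fixes H :: "'a::euclidean_space set"
  assumes "finite I" "affine H" "\<And>i. i \<in> I \<Longrightarrow> convex (K i)"
  defines "S \<equiv> UNIV - (\<Union>i\<in>I. K i)"
  shows "\<exists>\<L>. finite \<L> \<and> card \<L> \<le> 2 ^ card I * card I \<and> (\<forall>L\<in>\<L>. affine L \<and> L \<subset> H) \<and>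
           S \<inter> H \<subseteq> closure (top_of_set H interior_of S) \<union> \<Union>\<L>"
proof -
  define U where "U i = top_of_set H interior_of (K i)" for i
  have U: "convex (U i)" "openin (top_of_set H) (U i)" "U i \<subseteq> K i" if "i \<in> I" for i
    unfolding U_def using that assms convex_interior_of_affine
    by (auto simp: interior_of_subset)
  \<comment> \<open>The factor \<open>H\<close> turns the empty intersection into \<open>H\<close>,
    so the empty \<open>J\<close> qualifies only if \<open>H\<close> is empty.\<close>
  define \<J> where "\<J> = {J. J \<subseteq> I \<and> (\<forall>i\<in>J. U i \<noteq> {}) \<and> H \<inter> (\<Inter>i\<in>J. U i) = {}}"
  have "\<exists>\<L>. finite \<L> \<and> card \<L> \<le> card J \<and> (\<forall>L\<in>\<L>. affine L \<and> L \<subset> H) \<and>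
          H \<inter> (\<Inter>i\<in>J. closure (U i)) \<subseteq> \<Union>\<L>" if "J \<in> \<J>" for J
    using that assms U finite_subset[of J I] affine_imp_convex unfolding \<J>_def
    by (intro empty_intersection_closures_covered) auto
  then obtain \<L> where \<L>: "\<And>J. J \<in> \<J> \<Longrightarrow> finite (\<L> J) \<and> card (\<L> J) \<le> card J \<and>
      (\<forall>L\<in>\<L> J. affine L \<and> L \<subset> H) \<and> H \<inter> (\<Inter>i\<in>J. closure (U i)) \<subseteq> \<Union>(\<L> J)"
    by metis
  have \<J>: "finite \<J>" "card \<J> \<le> 2 ^ card I"
  proof -
    have "\<J> \<subseteq> Pow I" unfolding \<J>_def by auto
    then show "finite \<J>" "card \<J> \<le> 2 ^ card I"
      using assms(1) finite_subset card_mono[of "Pow I" \<J>] by (auto simp: card_Pow)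
  qed
  have "card (\<Union>(\<L> ` \<J>)) \<le> (\<Sum>J\<in>\<J>. card (\<L> J))"
    using \<J>(1) by (rule card_UN_le)
  also have "\<dots> \<le> (\<Sum>J\<in>\<J>. card I)"
    using \<L> assms(1) by (intro sum_mono) (metis (no_types, lifting) \<J>_def card_mono le_trans mem_Collect_eq)
  also have "\<dots> \<le> 2 ^ card I * card I"
    using \<J>(2) by simp
  finally have card: "card (\<Union>(\<L> ` \<J>)) \<le> 2 ^ card I * card I" .
  have "S \<inter> H \<subseteq> closure (top_of_set H interior_of S) \<union> \<Union>(\<Union>(\<L> ` \<J>))"
  proof
    fix p assume p: "p \<in> S \<inter> H"
    show "p \<in> closure (top_of_set H interior_of S) \<union> \<Union>(\<Union>(\<L> ` \<J>))"
    proof (rule ccontr)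
      assume contra: "\<not> ?thesis"
      define J where "J = {i\<in>I. p \<in> closure (U i)}"
      have "J \<notin> \<J>"
        using contra \<L>[of J] p unfolding J_def by blast
      then obtain w where w: "w \<in> H" "\<And>i. i \<in> J \<Longrightarrow> w \<in> U i"
        unfolding \<J>_def J_def by fastforce
      \<comment> \<open>Near \<open>p\<close> the sets \<open>U i\<close> with \<open>i \<in> J\<close> are dense. Hence the point \<open>y\<close>, slightly beyond
        \<open>p\<close> as seen from \<open>w\<close>, is in the closure of one of them, which then contains \<open>p\<close> itself.\<close>
      define B where "B = - (closure (top_of_set H interior_of S) \<union> (\<Union>i\<in>I-J. closure (U i)))"
      have B: "open B" "p \<in> B"
        unfolding B_def using assms(1) contra J_def by (auto intro!: closed_Un closed_UN)
      then obtain e where e: "e > 0" "ball p e \<subseteq> B"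
        using open_contains_ball by blast
      \<comment> \<open>The summand 1 keeps the denominator positive even if \<open>w = p\<close>,
        which is excluded only later.\<close>
      define t where "t = e / (2 * norm (w - p) + 1)"
      define y where "y = p + t *\<^sub>R (p - w)"
      have ne: "2 * norm (w - p) + 1 > 0"
        by (simp add: add_nonneg_pos)
      have t: "t > 0"
        unfolding t_def using e ne by simp
      have "t * norm (p - w) < e"
        unfolding t_def using e ne by (simp add: norm_minus_commute field_simps)
          (smt (verit) mult_nonneg_nonneg norm_ge_zero)
      then have yB: "y \<in> B"
        using e t unfolding y_def by (intro subsetD[OF e(2)]) (simp add: dist_norm)
      have yH: "y \<in> H"
        unfolding y_def using mem_affine_3_minus[OF \<open>affine H\<close>, of p p w t] p w by simp
      have "y \<in> closure (\<Union>i\<in>J. U i)"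
        unfolding closure_iff_nhds_not_empty
      proof (intro allI impI)
        fix X T assume T: "T \<subseteq> X" "open T" "y \<in> T"
        define V where "V = H \<inter> (T \<inter> B)"
        have "openin (top_of_set H) V" "V \<noteq> {}"
          using T B yB yH unfolding V_def by (auto intro: openin_open_Int)
        \<comment> \<open>\<open>B\<close> avoids the interior of \<open>S\<close> in
          \<open>H\<close>, so \<open>V'\<close> falls into some \<open>K i\<close> and hence into
          \<open>U i\<close>; \<open>B\<close> also avoids the closures with index outside
          \<open>J\<close>, so \<open>i \<in> J\<close>.\<close>
        then obtain V' where V': "V' \<subseteq> V" "openin (top_of_set H) V'" "V' \<noteq> {}"
            "(\<exists>i\<in>I. V' \<subseteq> K i) \<or> V' \<inter> (\<Union>i\<in>I. K i) = {}"
          using convex_family_openin_refine[where K = K and I = I and H = H and V = V] assms(1-3)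
          by auto
        have "\<not> V' \<subseteq> S"
        proof
          assume "V' \<subseteq> S"
          then have "V' \<subseteq> top_of_set H interior_of S"
            using V'(2) by (rule interior_of_maximal)
          then show False
            using V'(1,3) closure_subset unfolding V_def B_def by blast
        qed
        then obtain i where i: "i \<in> I" "V' \<subseteq> K i"
          using V'(4) unfolding S_def by blast
        then have "V' \<subseteq> U i"
          unfolding U_def using V'(2) by (intro interior_of_maximal)
        moreover from this have "i \<in> J"
          using V'(1,3) i closure_subset unfolding V_def B_def by blast
        ultimately show "(\<Union>i\<in>J. U i) \<inter> X \<noteq> {}"
          using V' T unfolding V_def by blast
      qed
      moreover have "closure (\<Union>i\<in>J. U i) \<subseteq> (\<Union>i\<in>J. closure (U i))"
        using assms(1) closure_subset unfolding J_def by (intro closure_minimal closed_UN) fastforce+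
      ultimately obtain i where i: "i \<in> J" "y \<in> closure (U i)"
        by blast
      then have iI: "i \<in> I"
        unfolding J_def by blast
      have hull: "affine hull H = H"
        using assms(2) by (simp add: affine_hull_eq)
      have "affine hull U i = H"
        using affine_hull_openin[of H "U i", unfolded hull] U(2)[OF iI] w(2)[OF i(1)] by blast
      then have "rel_interior (U i) = U i"
        using U(2)[OF iI] by (simp add: rel_interior_openin)
      then have seg: "open_segment w y \<subseteq> U i"
        using rel_interior_closure_convex_segment[OF U(1)[OF iI] _ i(2), of w] w(2)[OF i(1)] by simp
      have "p \<noteq> w"
        using p w(2)[OF i(1)] U(3)[OF iI] iI unfolding S_def by blast
      moreover have "p = (1 - 1 / (1 + t)) *\<^sub>R w + (1 / (1 + t)) *\<^sub>R y"
      proof -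
        have eq: "1 - 1 / (1 + t) = t / (1 + t)" "1 / (1 + t) + t / (1 + t) = 1"
          using t by (simp_all add: field_simps)
        have "p = (1 / (1 + t) + t / (1 + t)) *\<^sub>R p"
          using eq(2) by simp
        also have "\<dots> = (t / (1 + t)) *\<^sub>R w + (1 / (1 + t)) *\<^sub>R y"
          unfolding y_def by (simp add: scaleR_left_distrib scaleR_right_diff_distrib scaleR_add_right)
        finally show ?thesis
          unfolding eq(1) .
      qed
      moreover have "w \<noteq> y"
        using \<open>p \<noteq> w\<close> calculation(2) by (metis scaleR_collapse)
      ultimately have "p \<in> open_segment w y"
        unfolding in_segment using t by (intro conjI exI[of _ "1 / (1 + t)"]) auto
      then show False
        using seg U(3)[OF iI] p iI unfolding S_def by blast
    qed
  qed
  then show ?thesis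
    using \<L> \<J>(1) card by (intro exI[of _ "\<Union>(\<L> ` \<J>)"]) blast
qed

text \<open>Induction on a strict bound \<open>k\<close> for the dimension, so that
  \<open>k = 0\<close> leaves only the empty \<open>H\<close>. The number \<open>g\<close> precedes
  \<open>K\<close> and \<open>H\<close> because one value has to serve all subflats arising in the
  step.\<close>

lemma complement_covered_by_flats:
  fixes n k :: nat
  shows "\<exists>g::nat. \<forall>(K :: nat \<Rightarrow> 'a::euclidean_space set) H.
           (\<forall>i\<in>{1..n}. convex (K i)) \<and> affine H \<and> aff_dim H < int k \<longrightarrow>
           (\<exists>C. finite C \<and> card C \<le> g \<and> (\<forall>F\<in>C. flat F) \<and>
             (\<forall>p\<in>(UNIV - (\<Union>i\<in>{1..n}. K i)) \<inter> H.
               \<exists>F\<in>C. p \<in> closure (top_of_set F interior_of (UNIV - (\<Union>i\<in>{1..n}. K i)))))"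
proof (induction k)
  case 0
  have "H = {}" if "aff_dim H < 0" for H :: "'a set"
    using that aff_dim_negative_iff by blast
  then show ?case
    by (intro exI[of _ 0] allI impI exI[of _ "{}"]) auto
next
  case (Suc k)
  then obtain g where g: "\<And>(K :: nat \<Rightarrow> 'a set) H. \<lbrakk>\<And>i. i \<in> {1..n} \<Longrightarrow> convex (K i); affine H; aff_dim H < int k\<rbrakk> \<Longrightarrow>
      \<exists>C. finite C \<and> card C \<le> g \<and> (\<forall>F\<in>C. flat F) \<and>
        (\<forall>p\<in>(UNIV - (\<Union>i\<in>{1..n}. K i)) \<inter> H.
          \<exists>F\<in>C. p \<in> closure (top_of_set F interior_of (UNIV - (\<Union>i\<in>{1..n}. K i))))"
    by metis
  show ?case
  \<comment> \<open>One flat for \<open>H\<close> itself and at most \<open>g\<close> for each of at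
    most \<open>2 ^ n * n\<close> subflats.\<close>
  proof (intro exI[of _ "Suc (2 ^ n * n * g)"] allI impI)
    fix K :: "nat \<Rightarrow> 'a set" and H :: "'a set"
    assume KH: "(\<forall>i\<in>{1..n}. convex (K i)) \<and> affine H \<and> aff_dim H < int (Suc k)"
    define S where "S = UNIV - (\<Union>i\<in>{1..n}. K i)"
    obtain \<L> where \<L>: "finite \<L>" "card \<L> \<le> 2 ^ n * n" "\<And>L. L \<in> \<L> \<Longrightarrow> affine L \<and> L \<subset> H"
        "S \<inter> H \<subseteq> closure (top_of_set H interior_of S) \<union> \<Union>\<L>"
      using complement_covered_up_to_interior[of "{1..n}" H K] KH unfolding S_def by auto
    have "\<exists>C. finite C \<and> card C \<le> g \<and> (\<forall>F\<in>C. flat F) \<and>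
        (\<forall>p\<in>S \<inter> L. \<exists>F\<in>C. p \<in> closure (top_of_set F interior_of S))" if "L \<in> \<L>" for L
    proof -
      have "aff_dim L < aff_dim H"
        using \<L>(3)[OF that] KH by (intro aff_dim_psubset) (simp add: affine_hull_eq[THEN iffD2])
      then show ?thesis
        using g[of K L] KH \<L>(3)[OF that] unfolding S_def by auto
    qed
    then obtain c where c: "\<And>L. L \<in> \<L> \<Longrightarrow> finite (c L) \<and> card (c L) \<le> g \<and> (\<forall>F\<in>c L. flat F) \<and>
        (\<forall>p\<in>S \<inter> L. \<exists>F\<in>c L. p \<in> closure (top_of_set F interior_of S))"
      by metis
    \<comment> \<open>\<open>H\<close> is left out when empty, since a flat is nonempty.\<close>
    define C where "C = (\<Union>(c ` \<L>)) \<union> ({H} - {{}})"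
    have "card (\<Union>(c ` \<L>)) \<le> (\<Sum>L\<in>\<L>. card (c L))"
      using \<L>(1) by (rule card_UN_le)
    also have "\<dots> \<le> card \<L> * g"
      using c by (intro sum_bounded_above[of _ _ g, simplified]) auto
    also have "\<dots> \<le> 2 ^ n * n * g"
      using \<L>(2) by simp
    finally have "card (\<Union>(c ` \<L>)) \<le> 2 ^ n * n * g" .
    moreover have "card C \<le> card (\<Union>(c ` \<L>)) + card ({H} - {{}})"
      unfolding C_def by (rule card_Un_le)
    moreover have "card ({H} - {{}}) \<le> 1"
      using card_mono[of "{H}" "{H} - {{}}"] by simp
    ultimately have "card C \<le> Suc (2 ^ n * n * g)"
      by linarith
    moreover have "finite C"
      unfolding C_def using \<L>(1) c by auto
    moreover have "\<forall>F\<in>C. flat F"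
      unfolding C_def using c KH by (auto simp: flat_def)
    moreover have "\<exists>F\<in>C. p \<in> closure (top_of_set F interior_of S)" if p: "p \<in> S \<inter> H" for p
    proof -
      consider "p \<in> closure (top_of_set H interior_of S)" | L where "L \<in> \<L>" "p \<in> L"
        using p \<L>(4) by blast
      then show ?thesis
      proof cases
        case 1
        then show ?thesis unfolding C_def by force
      next
        case 2
        then show ?thesis using p c[of L] unfolding C_def by blast
      qed
    qed
    ultimately show "\<exists>C. finite C \<and> card C \<le> Suc (2 ^ n * n * g) \<and> (\<forall>F\<in>C. flat F) \<and>
        (\<forall>p\<in>(UNIV - (\<Union>i\<in>{1..n}. K i)) \<inter> H.
          \<exists>F\<in>C. p \<in> closure (top_of_set F interior_of (UNIV - (\<Union>i\<in>{1..n}. K i))))"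
      unfolding S_def by blast
  qed
qed

section \<open>Convex sets covered by finitely many flats\<close>

text \<open>If \<open>x \<in> C\<close> is in \<open>A\<close> only, then for every other
  \<open>y \<in> C\<close> the infinite segment from \<open>x\<close> to \<open>y\<close> meets some
  member of the family in two points. That member contains the whole line, in particular
  \<open>x\<close>, so it is \<open>A\<close>.\<close>

lemma convex_subset_finite_Union_affine:
  fixes C :: "'a::euclidean_space set"
  assumes "finite \<F>" "convex C" "C \<noteq> {}" "\<And>A. A \<in> \<F> \<Longrightarrow> affine A" "C \<subseteq> \<Union>\<F>"
  shows "\<exists>A\<in>\<F>. C \<subseteq> A"
  using assms(1,4,5)
proof (induction \<F> rule: finite_induct)
  case empty
  then show ?case using \<open>C \<noteq> {}\<close> by simp
next
  case (insert A \<F>)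
  show ?case
  proof (cases "C \<subseteq> \<Union>\<F>")
    case True
    then show ?thesis using insert by blast
  next
    case False
    then obtain x where x: "x \<in> C" "x \<notin> \<Union>\<F>"
      by blast
    have "y \<in> A" if "y \<in> C" for y
    proof (cases "y = x")
      case True
      then show ?thesis using x insert.prems(2) by auto
    next
      case False
      have inf: "infinite (closed_segment x y)"
        using False by simp
      have "closed_segment x y \<subseteq> (\<Union>B\<in>insert A \<F>. closed_segment x y \<inter> B)"
        using closed_segment_subset[OF x(1) that assms(2)] insert.prems(2) by auto
      then obtain B where B: "B \<in> insert A \<F>" "infinite (closed_segment x y \<inter> B)"
        using inf insert.hyps(1) by (metis finite_UN finite_insert finite_subset)
      then obtain u where u: "u \<in> closed_segment x y \<inter> B"
        using not_finite_existsD by (metis all_not_in_conv finite.emptyI)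
      obtain v where v: "v \<in> closed_segment x y \<inter> B" "v \<noteq> u"
        using B(2) by (metis finite.simps finite_subset subsetI singletonI)
      have "affine B" using B insert.prems by blast
      obtain s t where s: "u = (1 - s) *\<^sub>R x + s *\<^sub>R y" and t: "v = (1 - t) *\<^sub>R x + t *\<^sub>R y"
        using u v by (auto simp: in_segment)
      have "s \<noteq> t" using s t v by auto
      have line: "(1 - r) *\<^sub>R x + r *\<^sub>R y \<in> B" for r
      proof -
        \<comment> \<open>\<open>q\<close> is the coordinate on the line in which \<open>u\<close>
          is 0 and \<open>v\<close> is 1.\<close>
        define q where "q = (r - s) / (t - s)"
        have "q * (t - s) = r - s"
          unfolding q_def using \<open>s \<noteq> t\<close> by simp
        then have r: "r = (1 - q) * s + q * t"
          by (simp add: algebra_simps)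
        have "(1 - r) *\<^sub>R x + r *\<^sub>R y = (1 - q) *\<^sub>R u + q *\<^sub>R v"
          unfolding s t r by (simp add: algebra_simps)
        then show ?thesis
          using \<open>affine B\<close> u v mem_affine[of B u v "1 - q" q] by simp
      qed
      have "x \<in> B" "y \<in> B"
        using line[of 0] line[of 1] by auto
      then show ?thesis using x B by blast
    qed
    then show ?thesis by blast
  qed
qed

section \<open>Flat dimension and local dimension\<close>

lemma simplex_imp_dim_le_flat_dim:
  fixes S :: "'a::euclidean_space set"
  assumes "k simplex T" "T \<subseteq> S"
  shows "k \<le> flat_dim S"
  unfolding flat_dim_def using assms finite_subset[OF simplex_dims_subset]
  by (intro Max_ge) (auto simp: simplex_dims_def)

lemma flat_dim_mono:
  fixes S :: "'a::euclidean_space set"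
  assumes "S \<subseteq> T"
  shows "flat_dim S \<le> flat_dim T"
  using flat_dim_attained[of S] assms simplex_imp_dim_le_flat_dim unfolding simplex_dims_def by blast

lemma aff_dim_le_flat_dim:
  fixes S :: "'a::euclidean_space set"
  assumes "convex C" "C \<subseteq> S"
  shows "aff_dim C \<le> flat_dim S"
proof -
  obtain B where B: "B \<subseteq> C" "\<not> affine_dependent B" "affine hull C = affine hull B"
    using affine_basis_exists by blast
  have "aff_dim B = aff_dim C"
    using B(3) by (metis aff_dim_affine_hull)
  then have "aff_dim C simplex (convex hull B)"
    using B(2) by (auto simp: simplex_def aff_dim_affine_independent)
  moreover have "convex hull B \<subseteq> S"
    using B(1) assms hull_minimal[of B C convex] by blast
  ultimately show ?thesis
    by (rule simplex_imp_dim_le_flat_dim)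
qed

lemma finite_local_dims:
  fixes S :: "'a::euclidean_space set"
  shows "finite ((\<lambda>\<epsilon>. flat_dim (S \<inter> ball p \<epsilon>)) ` {0<..})"
proof (rule finite_subset)
  show "(\<lambda>\<epsilon>. flat_dim (S \<inter> ball p \<epsilon>)) ` {0<..} \<subseteq> {-1..int DIM('a)}"
    using flat_dim_attained simplex_dims_subset by blast
qed simp

lemma local_dim_le:
  fixes S :: "'a::euclidean_space set"
  assumes "e > 0"
  shows "local_dim S p \<le> flat_dim (S \<inter> ball p e)"
  unfolding local_dim_def using assms by (intro Min_le finite_local_dims) auto

text \<open>The minimum is attained at some radius, and the flat dimension cannot grow when the ball
  shrinks.\<close>

lemma local_dim_stable:
  fixes S :: "'a::euclidean_space set"
  obtains e where "e > 0" "\<And>r. \<lbrakk>0 < r; r \<le> e\<rbrakk> \<Longrightarrow> flat_dim (S \<inter> ball p r) = local_dim S p"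
proof -
  obtain e where e: "e > 0" "local_dim S p = flat_dim (S \<inter> ball p e)"
    using local_dim_attained[of S p] by auto
  have "flat_dim (S \<inter> ball p r) = local_dim S p" if "0 < r" "r \<le> e" for r
  proof -
    have "flat_dim (S \<inter> ball p r) \<le> flat_dim (S \<inter> ball p e)"
      using that by (intro flat_dim_mono) auto
    then show ?thesis using local_dim_le[OF that(1), of S p] e(2) by simp
  qed
  then show ?thesis using that e(1) by blast
qed

text \<open>Upper semicontinuity: at a radius \<open>e\<close> where the local dimension at
  \<open>p\<close> is attained, points of the ball have no larger local dimension.\<close>

lemma local_dim_le_flat_dim_ball:
  fixes S :: "'a::euclidean_space set"
  assumes "q \<in> ball p e"
  shows "local_dim S q \<le> flat_dim (S \<inter> ball p e)"
proof -
  obtain r where r: "r > 0" "ball q r \<subseteq> ball p e"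
    using assms open_contains_ball[THEN iffD1, OF open_ball] by blast
  show ?thesis
    using local_dim_le[OF r(1), of S q] flat_dim_mono[of "S \<inter> ball q r" "S \<inter> ball p e"] r(2)
    by force
qed

lemma local_dim_nonneg:
  fixes S :: "'a::euclidean_space set"
  assumes "p \<in> S"
  shows "0 \<le> local_dim S p"
proof -
  obtain e where e: "e > 0" "flat_dim (S \<inter> ball p e) = local_dim S p"
    using local_dim_stable[of S p] by (metis order_refl)
  show ?thesis
    using aff_dim_le_flat_dim[of "{p}" "S \<inter> ball p e"] e assms by simp
qed

lemma local_dim_eq_aff_dim:
  fixes S :: "'a::euclidean_space set"
  assumes "affine H" "open U" "q \<in> H \<inter> U" "S \<inter> U = H \<inter> U"
  shows "local_dim S q = aff_dim H"
proof -
  obtain e where e: "e > 0" "\<And>r. \<lbrakk>0 < r; r \<le> e\<rbrakk> \<Longrightarrow> flat_dim (S \<inter> ball q r) = local_dim S q"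
    using local_dim_stable[of S q] by metis
  obtain d where d: "d > 0" "ball q d \<subseteq> U"
    using assms open_contains_ball by blast
  define r where "r = min d e"
  have r: "r > 0" "ball q r \<subseteq> U"
    unfolding r_def using d e(1) by auto
  have eq: "S \<inter> ball q r = H \<inter> ball q r"
    using r(2) assms(4) by blast
  have "aff_dim (H \<inter> ball q r) = aff_dim H"
    using assms r(1) affine_imp_convex by (intro aff_dim_convex_Int_open) auto
  moreover have "convex (H \<inter> ball q r)"
    using assms(1) affine_imp_convex by (blast intro: convex_Int convex_ball)
  ultimately have "aff_dim H \<le> flat_dim (S \<inter> ball q r)"
    using aff_dim_le_flat_dim[of "H \<inter> ball q r" "S \<inter> ball q r"] eq by simp
  moreover have "flat_dim (S \<inter> ball q r) \<le> aff_dim H"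
  proof -
    obtain T where "flat_dim (S \<inter> ball q r) simplex T" "T \<subseteq> H"
      using flat_dim_attained[of "S \<inter> ball q r"] eq unfolding simplex_dims_def by blast
    then show ?thesis
      using aff_dim_simplex aff_dim_subset by metis
  qed
  ultimately show ?thesis
    using e(2)[OF r(1)] unfolding r_def by simp
qed

lemma ball_avoiding_flats:
  fixes C :: "'a::euclidean_space set set"
  assumes "finite C" "\<And>F. F \<in> C \<Longrightarrow> closed F \<and> p \<notin> F"
  obtains e where "e > 0" "\<And>F. F \<in> C \<Longrightarrow> F \<inter> ball p e = {}"
proof -
  have "open (- \<Union>C)" "p \<in> - \<Union>C"
    using assms by auto
  then obtain e where "e > 0" "ball p e \<subseteq> - \<Union>C"
    using open_contains_ball by blast
  then show ?thesis using that by blast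
qed

text \<open>One radius does two things: it attains the local dimension, and every flat of
  \<open>C\<close> meeting the ball passes through \<open>p\<close>. \<open>T\<close> is a convex
  witness of that dimension, nonempty because the dimension is at least 0.\<close>

lemma simplex_near:
  fixes S :: "'a::euclidean_space set"
  assumes "p \<in> S" "finite C" "\<And>F. F \<in> C \<Longrightarrow> flat F"
  obtains e T where "e > 0" "flat_dim (S \<inter> ball p e) = local_dim S p"
    "\<And>F. \<lbrakk>F \<in> C; F \<inter> ball p e \<noteq> {}\<rbrakk> \<Longrightarrow> p \<in> F"
    "convex T" "T \<noteq> {}" "T \<subseteq> S \<inter> ball p e" "aff_dim T = local_dim S p"
proof -
  obtain e where e: "e > 0" "\<And>r. \<lbrakk>0 < r; r \<le> e\<rbrakk> \<Longrightarrow> flat_dim (S \<inter> ball p r) = local_dim S p"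
    using local_dim_stable[of S p] by metis
  obtain d where d: "d > 0" "\<And>F. F \<in> {F\<in>C. p \<notin> F} \<Longrightarrow> F \<inter> ball p d = {}"
  proof (rule ball_avoiding_flats[of "{F\<in>C. p \<notin> F}" p])
    show "closed F \<and> p \<notin> F" if "F \<in> {F\<in>C. p \<notin> F}" for F
      using that assms(3) affine_closed unfolding flat_def by blast
  qed (use assms(2) in auto)
  define r where "r = min d e"
  have r: "r > 0" "r \<le> e" "ball p r \<subseteq> ball p d"
    unfolding r_def using d e by auto
  have fd: "flat_dim (S \<inter> ball p r) = local_dim S p"
    using e r by blast
  obtain T where T: "local_dim S p simplex T" "T \<subseteq> S \<inter> ball p r"
    using flat_dim_attained[of "S \<inter> ball p r"] fd unfolding simplex_dims_def by auto
  have dim: "aff_dim T = local_dim S p"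
    using T(1) by (rule aff_dim_simplex)
  moreover have "T \<noteq> {}"
    using dim local_dim_nonneg[OF assms(1)] by auto
  moreover have "convex T"
    using T(1) convex_convex_hull by (auto simp: simplex_def)
  moreover have "p \<in> F" if "F \<in> C" "F \<inter> ball p r \<noteq> {}" for F
    using that d(2)[of F] r(3) by blast
  ultimately show ?thesis
    using that[of r T] r(1) fd T(2) by blast
qed

section \<open>Dimension-exact covers and ordinary flats\<close>

text \<open>The simplex \<open>T\<close> lies in a single \<open>F \<in> C\<close> whose
  \<open>top_of_set F interior_of S\<close> meets the ball. Containing \<open>T\<close> bounds the
  dimension of \<open>F\<close> from below; an open piece of \<open>F\<close> inside
  \<open>S\<close> and the ball bounds it from above.\<close>

lemma dim_cover_closure_interior_of:
  fixes S :: "'a::euclidean_space set"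
  assumes C: "finite C" "\<And>F. F \<in> C \<Longrightarrow> flat F"
    and cl: "\<And>p. p \<in> S \<Longrightarrow> \<exists>F\<in>C. p \<in> closure (top_of_set F interior_of S)"
  shows "dim_cover S C"
  unfolding dim_cover_def
proof
  fix p assume p: "p \<in> S"
  obtain e T where e: "e > 0" "flat_dim (S \<inter> ball p e) = local_dim S p"
      "\<And>F. \<lbrakk>F \<in> C; F \<inter> ball p e \<noteq> {}\<rbrakk> \<Longrightarrow> p \<in> F"
    and T: "convex T" "T \<noteq> {}" "T \<subseteq> S \<inter> ball p e" "aff_dim T = local_dim S p"
    using simplex_near[OF p C] by metis
  define C' where "C' = {F\<in>C. (top_of_set F interior_of S) \<inter> ball p e \<noteq> {}}"
  have "T \<subseteq> \<Union>C'"
  proof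
    fix x assume x: "x \<in> T"
    then obtain F where F: "F \<in> C" "x \<in> closure (top_of_set F interior_of S)"
      using cl T(3) by blast
    have "closure (top_of_set F interior_of S) \<subseteq> F"
      using affine_closed C(2)[OF F(1)] interior_of_subset_topspace[of "top_of_set F" S]
      unfolding flat_def by (intro closure_minimal) auto
    moreover have "(top_of_set F interior_of S) \<inter> ball p e \<noteq> {}"
      using F(2) T(3) x open_Int_closure_eq_empty[OF open_ball, of p e "top_of_set F interior_of S"]
      by blast
    ultimately show "x \<in> \<Union>C'"
      using F unfolding C'_def by blast
  qed
  then obtain F where F: "F \<in> C'" "T \<subseteq> F"
    using convex_subset_finite_Union_affine[of C' T] C T(1,2) unfolding C'_def flat_def by auto
  have FC: "F \<in> C" "affine F"
    using F C unfolding C'_def flat_def by auto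
  obtain x where x: "x \<in> top_of_set F interior_of S" "x \<in> ball p e"
    using F unfolding C'_def by blast
  have "aff_dim F \<le> flat_dim (S \<inter> ball p e)"
  proof -
    obtain d where d: "d > 0" "ball x d \<inter> F \<subseteq> top_of_set F interior_of S"
      using openin_interior_of[of "top_of_set F" S] x(1) by (metis openin_contains_ball)
    define V where "V = F \<inter> (ball x d \<inter> ball p e)"
    have "x \<in> F"
      using x(1) interior_of_subset_topspace[of "top_of_set F" S] by auto
    then have "F \<inter> (ball x d \<inter> ball p e) \<noteq> {}"
      using d(1) x(2) by (metis IntI centre_in_ball empty_iff)
    then have "aff_dim V = aff_dim F"
      unfolding V_def by (intro aff_dim_convex_Int_open affine_imp_convex FC(2) open_Int open_ball)
    moreover have "convex V"
      unfolding V_def using FC(2) affine_imp_convex by (blast intro: convex_Int convex_ball)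
    moreover have "V \<subseteq> S \<inter> ball p e"
      unfolding V_def using d(2) interior_of_subset[of "top_of_set F" S] by blast
    ultimately show ?thesis
      using aff_dim_le_flat_dim by metis
  qed
  moreover have "aff_dim T \<le> aff_dim F"
    using F(2) by (rule aff_dim_subset)
  ultimately have "aff_dim F = local_dim S p"
    using e(2) T(4) by linarith
  moreover have "p \<in> F"
    using e(3)[OF FC(1)] F(2) T(2,3) by blast
  ultimately show "\<exists>H\<in>C. k_flat (local_dim S p) H \<and> p \<in> H"
    using FC C unfolding k_flat_def by blast
qed

text \<open>On a patch \<open>V\<close> where \<open>S\<close> agrees with \<open>H\<close>, the
  local dimension is \<open>aff_dim H\<close>, so flats of \<open>C\<close> of that dimension cover
  \<open>V\<close>. One of them contains \<open>V\<close>, hence its span \<open>H\<close>, and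
  equal dimensions make it \<open>H\<close>.\<close>

lemma ordinary_flat_in_dim_cover:
  fixes S :: "'a::euclidean_space set"
  assumes "finite C" "dim_cover S C" "ordinary_flat S H"
  shows "H \<in> C"
proof -
  obtain q U where H: "affine H" and qU: "q \<in> S" "open U" "q \<in> U" "S \<inter> U = H \<inter> U"
    using assms(3) unfolding ordinary_flat_def k_ordinary_flat_def k_flat_def flat_def by blast
  obtain e where e: "e > 0" "ball q e \<subseteq> U"
    using qU open_contains_ball by blast
  define V where "V = H \<inter> ball q e"
  have qH: "q \<in> H" using qU by blast
  have conv: "convex V"
    unfolding V_def using H affine_imp_convex by (blast intro: convex_Int convex_ball)
  have ne: "V \<noteq> {}"
    unfolding V_def using qH e(1) by auto
  have hull: "affine hull V = H"
    unfolding V_def using H ne[unfolded V_def] by (simp add: affine_hull_affine_Int_open affine_hull_eq)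
  define C' where "C' = {F\<in>C. k_flat (aff_dim H) F}"
  have "V \<subseteq> \<Union>C'"
  proof
    fix x assume x: "x \<in> V"
    then have xU: "x \<in> H \<inter> U" and xS: "x \<in> S"
      using e qU unfolding V_def by blast+
    have "local_dim S x = aff_dim H"
      using local_dim_eq_aff_dim[OF H qU(2) xU qU(4)] .
    then show "x \<in> \<Union>C'"
      using assms(2) xS unfolding dim_cover_def C'_def by fastforce
  qed
  moreover have aff: "affine F \<and> aff_dim F = aff_dim H" if "F \<in> C'" for F
    using that unfolding C'_def k_flat_def flat_def by blast
  moreover have "finite C'"
    using assms(1) unfolding C'_def by simp
  ultimately obtain F where F: "F \<in> C'" "V \<subseteq> F"
    using convex_subset_finite_Union_affine[of C' V] conv ne by blast
  have "H \<subseteq> F"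
    using F(2) aff[OF F(1)] hull_minimal[of V F affine] hull by simp
  then have "H = F"
    using aff[OF F(1)] H qH by (intro affine_dim_equal) auto
  then show ?thesis using F(1) unfolding C'_def by blast
qed

text \<open>By minimality some \<open>p\<close> is served by \<open>H\<close> alone. Near
  \<open>p\<close>, \<open>S\<close> lies in \<open>H\<close> and finitely many flats of lower
  dimension, and a simplex \<open>T\<close> of full local dimension in \<open>S\<close> lies in
  \<open>H\<close>. At a relative interior point \<open>q\<close> of \<open>T\<close> off the lower
  flats, \<open>S\<close> agrees with \<open>H\<close>.\<close>

lemma strong_cover_imp_ordinary_flat:
  fixes S :: "'a::euclidean_space set"
  assumes "strong_cover S C" "H \<in> C"
  shows "ordinary_flat S H"
proof -
  have C: "finite C" "\<And>F. F \<in> C \<Longrightarrow> flat F" and cov: "dim_cover S C"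
    using assms(1) unfolding strong_cover_def by auto
  have "\<not> dim_cover S (C - {H})"
    using assms unfolding strong_cover_def by blast
  then obtain p where p: "p \<in> S" "\<And>F. \<lbrakk>F \<in> C; F \<noteq> H; k_flat (local_dim S p) F\<rbrakk> \<Longrightarrow> p \<notin> F"
    unfolding dim_cover_def by blast
  then have H: "k_flat (local_dim S p) H"
    using cov unfolding dim_cover_def by blast
  then have affH: "affine H" and dimH: "aff_dim H = local_dim S p"
    unfolding k_flat_def flat_def by auto
  obtain e T where e: "e > 0" "flat_dim (S \<inter> ball p e) = local_dim S p"
      "\<And>F. \<lbrakk>F \<in> C; F \<inter> ball p e \<noteq> {}\<rbrakk> \<Longrightarrow> p \<in> F"
    and T: "convex T" "T \<noteq> {}" "T \<subseteq> S \<inter> ball p e" "aff_dim T = local_dim S p"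
    using simplex_near[OF p(1) C] by metis
  define C' where "C' = {F\<in>C. p \<in> F \<and> aff_dim F < local_dim S p}"
  \<comment> \<open>The flat serving \<open>x\<close> passes through \<open>p\<close> and has at
    most the local dimension at \<open>p\<close>; in case of equality it is \<open>H\<close> by the
    choice of \<open>p\<close>.\<close>
  have near: "x \<in> H \<union> \<Union>C'" if x: "x \<in> S \<inter> ball p e" for x
  proof -
    obtain F where F: "F \<in> C" "k_flat (local_dim S x) F" "x \<in> F"
      using cov x unfolding dim_cover_def by blast
    have "aff_dim F \<le> local_dim S p"
      using local_dim_le_flat_dim_ball[of x p e S] x e(2) F(2) unfolding k_flat_def by simp
    moreover have "p \<in> F"
      using e(3)[OF F(1)] F(3) x by blast
    moreover have "F = H" if "aff_dim F = local_dim S p"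
      using p(2)[OF F(1)] \<open>p \<in> F\<close> that C(2)[OF F(1)] unfolding k_flat_def by blast
    ultimately show ?thesis
      using F unfolding C'_def by fastforce
  qed
  have C': "finite C'" "\<And>F. F \<in> C' \<Longrightarrow> affine F"
    using C unfolding C'_def flat_def by auto
  have "T \<subseteq> \<Union>(insert H C')"
    using near T(3) by blast
  then obtain F where F: "F \<in> insert H C'" "T \<subseteq> F"
    using convex_subset_finite_Union_affine[of "insert H C'" T] T(1,2) C' affH by blast
  moreover have "F \<notin> C'"
    using aff_dim_subset[OF F(2)] T(4) unfolding C'_def by auto
  ultimately have TH: "T \<subseteq> H"
    by blast
  then have hullT: "affine hull T = H"
    using T affH dimH by (metis aff_dim_affine_hull affine_affine_hull affine_dim_equal affine_hull_eq_empty hull_minimal)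
  have "\<not> rel_interior T \<subseteq> \<Union>C'"
  proof
    assume "rel_interior T \<subseteq> \<Union>C'"
    then obtain F where "F \<in> C'" "rel_interior T \<subseteq> F"
      using convex_subset_finite_Union_affine[of C' "rel_interior T"] C'
        rel_interior_eq_empty[OF T(1)] T(2) convex_rel_interior[OF T(1)] by blast
    then show False
      using aff_dim_subset[of "rel_interior T" F] rel_interior_aff_dim[OF T(1)] T(4)
      unfolding C'_def by auto
  qed
  then obtain q where q: "q \<in> rel_interior T" "\<And>F. F \<in> C' \<Longrightarrow> q \<notin> F"
    by blast
  obtain d where d: "d > 0" "ball q d \<inter> H \<subseteq> T"
    using q(1) hullT by (auto simp: mem_rel_interior_ball)
  obtain c where c: "c > 0" "\<And>F. F \<in> C' \<Longrightarrow> F \<inter> ball q c = {}"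
  proof (rule ball_avoiding_flats[of C' q])
    show "closed F \<and> q \<notin> F" if "F \<in> C'" for F
      using that q(2)[OF that] C'(2)[OF that] affine_closed by blast
  qed (use C'(1) in auto)
  \<comment> \<open>\<open>ball p e\<close> confines \<open>S\<close> to
    \<open>H \<union> \<Union>C'\<close>, \<open>ball q c\<close> removes the members of
    \<open>C'\<close>, and \<open>ball q d\<close> puts \<open>H\<close> inside \<open>T\<close> and
    thus inside \<open>S\<close>.\<close>
  define U where "U = ball q d \<inter> ball q c \<inter> ball p e"
  have qT: "q \<in> T"
    using q(1) rel_interior_subset by blast
  have U: "open U" "q \<in> U"
    unfolding U_def using c(1) d(1) qT T(3) by auto
  have eq: "S \<inter> U = H \<inter> U"
    using near c(2) d(2) T(3) unfolding U_def by blast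
  have "local_dim S q = local_dim S p"
    using local_dim_eq_aff_dim[OF affH U(1) _ eq] U(2) qT TH dimH by auto
  then have "k_ordinary_flat (local_dim S p) S H"
    unfolding k_ordinary_flat_def using H U eq qT T(3) by blast
  then show ?thesis
    unfolding ordinary_flat_def using local_dim_nonneg[OF p(1)] dimH aff_dim_le_DIM[of H] by metis
qed

lemma strong_cover_eq_ordinary_flats:
  fixes S :: "'a::euclidean_space set"
  assumes "strong_cover S C"
  shows "C = {H. ordinary_flat S H}"
  using assms strong_cover_imp_ordinary_flat[OF assms] ordinary_flat_in_dim_cover[of C S]
  unfolding strong_cover_def by blast

lemma dim_cover_contains_strong_cover:
  fixes S :: "'a::euclidean_space set"
  assumes "finite C" "\<forall>H\<in>C. flat H" "dim_cover S C"
  obtains C' where "C' \<subseteq> C" "strong_cover S C'"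
proof -
  define \<D> where "\<D> = {D. D \<subseteq> C \<and> dim_cover S D}"
  have "finite \<D>" "C \<in> \<D>"
    unfolding \<D>_def using assms by simp_all
  then obtain C' where C': "C' \<in> \<D>" "\<forall>D\<in>\<D>. D \<subseteq> C' \<longrightarrow> C' = D"
    using finite_has_minimal2[of \<D> C] by blast
  have "C' \<subseteq> C" "dim_cover S C'"
    using C'(1) unfolding \<D>_def by auto
  moreover have "\<not> dim_cover S D" if "D \<subset> C'" for D
    using C'(2) that \<open>C' \<subseteq> C\<close> unfolding \<D>_def by blast
  moreover have "finite C'"
    using \<open>C' \<subseteq> C\<close> assms(1) by (rule finite_subset)
  ultimately have "strong_cover S C'"
    unfolding strong_cover_def using assms(2) by blast
  then show ?thesis using that \<open>C' \<subseteq> C\<close> by blast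
qed

section \<open>Existence, uniqueness and size of the strong cover\<close>

theorem theorem1p6:
  fixes n :: nat
  shows "\<exists>g::nat. \<forall>(K :: nat \<Rightarrow> (real ^ 'd) set) S.
           (\<forall>i\<in>{1..n}. convex (K i)) \<and> S = UNIV - (\<Union>i\<in>{1..n}. K i) \<longrightarrow>
             (\<exists>C. (\<forall>H\<in>C. flat H) \<and> finite C \<and> card C \<le> g \<and> dim_cover S C) \<and>
             (\<exists>!C. strong_cover S C) \<and>
             (\<forall>C. strong_cover S C \<longrightarrow> card C \<le> g \<and> C = {H. ordinary_flat S H})"
proof -
  \<comment> \<open>The flat to start from is the whole space; the bound in the induction is strict,
    hence the \<open>Suc\<close>.\<close>
  have dim: "aff_dim (UNIV :: (real ^ 'd) set) < int (Suc DIM(real ^ 'd))"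
    by (rule order.strict_trans1[OF aff_dim_le_DIM]) simp
  obtain g where g: "\<forall>(K :: nat \<Rightarrow> (real ^ 'd) set) H.
      (\<forall>i\<in>{1..n}. convex (K i)) \<and> affine H \<and> aff_dim H < int (Suc DIM(real ^ 'd)) \<longrightarrow>
      (\<exists>C. finite C \<and> card C \<le> g \<and> (\<forall>F\<in>C. flat F) \<and>
        (\<forall>p\<in>(UNIV - (\<Union>i\<in>{1..n}. K i)) \<inter> H.
          \<exists>F\<in>C. p \<in> closure (top_of_set F interior_of (UNIV - (\<Union>i\<in>{1..n}. K i)))))"
    using complement_covered_by_flats[where 'a = "real ^ 'd" and n = n and k = "Suc DIM(real ^ 'd)"]
    by (elim exE)
  show ?thesis
  proof (intro exI[of _ g] allI impI)
    fix K :: "nat \<Rightarrow> (real ^ 'd) set" and S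
    assume KS: "(\<forall>i\<in>{1..n}. convex (K i)) \<and> S = UNIV - (\<Union>i\<in>{1..n}. K i)"
    obtain C where C: "finite C" "card C \<le> g" "\<forall>F\<in>C. flat F"
        "\<forall>p\<in>S. \<exists>F\<in>C. p \<in> closure (top_of_set F interior_of S)"
      using g[THEN spec[of _ K], THEN spec[of _ UNIV]] KS dim by auto
    have cov: "dim_cover S C"
      using dim_cover_closure_interior_of[of C S] C by blast
    obtain D where D: "D \<subseteq> C" "strong_cover S D"
      using dim_cover_contains_strong_cover[OF C(1,3) cov] .
    have "card D \<le> g"
      using card_mono[OF C(1) D(1)] C(2) by simp
    moreover have D_eq: "D = {H. ordinary_flat S H}"
      using strong_cover_eq_ordinary_flats[OF D(2)] .
    \<comment> \<open>Every strong cover is the set of ordinary flats, which depends on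
      \<open>S\<close> only.\<close>
    moreover have uniq: "E = D" if "strong_cover S E" for E
      unfolding D_eq using strong_cover_eq_ordinary_flats[OF that] .
    moreover have "\<exists>!C. strong_cover S C"
      using D(2) uniq by (rule ex1I)
    ultimately show "(\<exists>C. (\<forall>H\<in>C. flat H) \<and> finite C \<and> card C \<le> g \<and> dim_cover S C) \<and>
        (\<exists>!C. strong_cover S C) \<and>
        (\<forall>C. strong_cover S C \<longrightarrow> card C \<le> g \<and> C = {H. ordinary_flat S H})"
      using C(1-3) cov by (intro conjI exI[of _ C] allI impI) auto
  qed
qed

end
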